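(* Let $X_\rho$ be a $\rho$-complete modular space where $\rho$ satisfies the regular growth condition, and let $B\subseteq X_\rho$ be a $\rho$-closed and star-shaped subset of $X_\rho$. Let $T:B\to B$ be a $\rho$-nonexpansive mapping, i.e. $\rho(Tx-Ty)\le\rho(x-y)$ for all $x,y\in B$. If the $\rho$-closure $\overline{T(B)}^{\rho}$ of $T(B)$ is $\rho$-compact, then $T$ has a fixed point.
   Context: A modular on a real or complex vector space $X$ is a functional $\rho:X\to[0,+\infty]$ such that $\rho(x)=0$ if and only if $x=0$; $\rho(\alpha x)=\rho(x)$ for every scalar $\alpha$ with $|\alpha|=1$; and $\rho(\alpha x+\beta y)\le\rho(x)+\rho(y)$ for all $x,y\in X$ and $\alpha,\beta\ge 0$ with $\alpha+\beta=1$. The associated modular space is $X_\rho=\{x\in X:\rho(\lambda x)\to 0\text{ as }\lambda\to 0\}$. $X_\rho$ is equipped with the following convergence: $(x_n)$ is $\rho$-convergent to $x$ if $\rho(x_n-x)\to 0$ as $n\to+\infty$. $X_\rho$ is $\rho$-complete if every sequence $(x_n)$ in $X_\rho$ with $\rho(x_n-x_m)\to 0$ as $n,m\to+\infty$ is $\rho$-convergent to some $x\in X_\rho$. A subset of $X_\rho$ is $\rho$-closed if it contains the limit of each of its $\rho$-convergent sequences; the $\rho$-closure $\overline{A}^{\rho}$ of a set $A\subseteq X_\rho$ is the smallest $\rho$-closed set containing $A$; a set is $\rho$-compact if every sequence in it has a subsequence $\rho$-convergent to a point of the set. The modular $\rho$ satisfies the regular growth condition if $W_\rho(t)<1$ for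 all $t\in[0,1[$, where $W_\rho(t)=\sup\{\rho(tx)/\rho(x): x\in X_\rho,\ 0<\rho(x)<\infty\}$. A set $B$ is star-shaped if there exists $z\in B$ such that $\alpha z+\beta x\in B$ for all $x\in B$ and all real $\alpha,\beta>0$ with $\alpha+\beta=1$. *)

theory Defs
  imports "HOL-Analysis.Analysis"
begin

text \<open>
  Real and complex vector spaces are treated uniformly: the scalars range over a type \<open>'k\<close> of
  class \<open>real_normed_field\<close>. Both \<open>real\<close> and \<open>complex\<close> are instances, and by the
  Gelfand-Mazur theorem every instance is isometrically isomorphic to one of them. The modulus of a
  scalar is its norm, and real coefficients are embedded by \<open>of_real\<close>.
\<close>

locale modular = vector_space smul
  for smul :: "'k::real_normed_field \<Rightarrow> 'a::ab_group_add \<Rightarrow> 'a" (infixr \<open>*\<^sub>s\<close> 75) +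
  fixes \<rho> :: "'a \<Rightarrow> ennreal"
  assumes modular_eq_0_iff: "\<rho> x = 0 \<longleftrightarrow> x = 0"
    and modular_unit_scale: "norm \<alpha> = 1 \<Longrightarrow> \<rho> (\<alpha> *\<^sub>s x) = \<rho> x"
    and modular_convex_comb: "a \<ge> 0 \<Longrightarrow> b \<ge> 0 \<Longrightarrow> a + b = 1 \<Longrightarrow>
          \<rho> (of_real a *\<^sub>s x + of_real b *\<^sub>s y) \<le> \<rho> x + \<rho> y"

definition modular_space ::
    "('k::real_normed_field \<Rightarrow> 'a::ab_group_add \<Rightarrow> 'a) \<Rightarrow> ('a \<Rightarrow> ennreal) \<Rightarrow> 'a set" where
  "modular_space smul \<rho> = {x. ((\<lambda>c. \<rho> (smul c x)) \<longlongrightarrow> 0) (at 0)}"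

definition modular_converges ::
    "('a::ab_group_add \<Rightarrow> ennreal) \<Rightarrow> (nat \<Rightarrow> 'a) \<Rightarrow> 'a \<Rightarrow> bool" where
  "modular_converges \<rho> u x \<longleftrightarrow> (\<lambda>n. \<rho> (u n - x)) \<longlonglongrightarrow> 0"

definition modular_complete ::
    "('k::real_normed_field \<Rightarrow> 'a::ab_group_add \<Rightarrow> 'a) \<Rightarrow> ('a \<Rightarrow> ennreal) \<Rightarrow> bool" where
  "modular_complete smul \<rho> \<longleftrightarrow>
     (\<forall>u. (\<forall>n. u n \<in> modular_space smul \<rho>) \<longrightarrow>
          ((\<lambda>(n, m). \<rho> (u n - u m)) \<longlongrightarrow> 0) (sequentially \<times>\<^sub>F sequentially) \<longrightarrow>
          (\<exists>x \<in> modular_space smul \<rho>. modular_converges \<rho> u x))"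

definition modular_closed ::
    "('k::real_normed_field \<Rightarrow> 'a::ab_group_add \<Rightarrow> 'a) \<Rightarrow> ('a \<Rightarrow> ennreal) \<Rightarrow> 'a set \<Rightarrow> bool" where
  "modular_closed smul \<rho> A \<longleftrightarrow>
     A \<subseteq> modular_space smul \<rho> \<and>
     (\<forall>u. \<forall>x \<in> modular_space smul \<rho>.
        (\<forall>n. u n \<in> A) \<longrightarrow> modular_converges \<rho> u x \<longrightarrow> x \<in> A)"

definition modular_closure ::
    "('k::real_normed_field \<Rightarrow> 'a::ab_group_add \<Rightarrow> 'a) \<Rightarrow> ('a \<Rightarrow> ennreal) \<Rightarrow> 'a set \<Rightarrow> 'a set" where
  "modular_closure smul \<rho> A = modular_closed smul \<rho> hull A"

definition modular_compact :: "('a::ab_group_add \<Rightarrow> ennreal) \<Rightarrow> 'a set \<Rightarrow> bool" where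
  "modular_compact \<rho> A \<longleftrightarrow>
     (\<forall>u. (\<forall>n. u n \<in> A) \<longrightarrow>
        (\<exists>r :: nat \<Rightarrow> nat. \<exists>x \<in> A. strict_mono r \<and> modular_converges \<rho> (u \<circ> r) x))"

text \<open>The supremum is taken in \<open>[0, \<infinity>]\<close>; in particular it is \<open>0\<close> over the empty set.\<close>

definition modular_growth ::
    "('k::real_normed_field \<Rightarrow> 'a::ab_group_add \<Rightarrow> 'a) \<Rightarrow> ('a \<Rightarrow> ennreal) \<Rightarrow> real \<Rightarrow> ennreal" where
  "modular_growth smul \<rho> t =
     (SUP x \<in> {x \<in> modular_space smul \<rho>. 0 < \<rho> x \<and> \<rho> x < \<infinity>}. \<rho> (smul (of_real t) x) / \<rho> x)"

definition regular_growth ::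
    "('k::real_normed_field \<Rightarrow> 'a::ab_group_add \<Rightarrow> 'a) \<Rightarrow> ('a \<Rightarrow> ennreal) \<Rightarrow> bool" where
  "regular_growth smul \<rho> \<longleftrightarrow> (\<forall>t \<in> {0..<1}. modular_growth smul \<rho> t < 1)"

definition star_shaped ::
    "('k::real_normed_field \<Rightarrow> 'a::ab_group_add \<Rightarrow> 'a) \<Rightarrow> 'a set \<Rightarrow> bool" where
  "star_shaped smul B \<longleftrightarrow>
     (\<exists>z \<in> B. \<forall>x \<in> B. \<forall>a b :: real. a > 0 \<longrightarrow> b > 0 \<longrightarrow> a + b = 1 \<longrightarrow>
        smul (of_real a) z + smul (of_real b) x \<in> B)"

definition modular_nonexpansive_on ::
    "('a::ab_group_add \<Rightarrow> ennreal) \<Rightarrow> 'a set \<Rightarrow> ('a \<Rightarrow> 'a) \<Rightarrow> bool" where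
  "modular_nonexpansive_on \<rho> B T \<longleftrightarrow> (\<forall>x \<in> B. \<forall>y \<in> B. \<rho> (T x - T y) \<le> \<rho> (x - y))"

lemma modular_closed_modular_closure:
  assumes "A \<subseteq> modular_space smul \<rho>"
  shows "modular_closed smul \<rho> (modular_closure smul \<rho> A)"
proof -
  let ?F = "{C. modular_closed smul \<rho> C \<and> A \<subseteq> C}"
  have top: "modular_space smul \<rho> \<in> ?F"
    using assms by (simp add: modular_closed_def)
  have "\<Inter>?F \<subseteq> modular_space smul \<rho>"
    using top by blast
  moreover have "x \<in> \<Inter>?F" if "x \<in> modular_space smul \<rho>" "\<forall>n. u n \<in> \<Inter>?F"
    "modular_converges \<rho> u x" for u x
  proof (rule InterI)
    fix C assume C: "C \<in> ?F"
    then have "\<forall>n. u n \<in> C"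
      using that(2) by blast
    then show "x \<in> C"
      using C that(1,3) unfolding modular_closed_def by blast
  qed
  ultimately show ?thesis
    unfolding modular_closure_def hull_def modular_closed_def[of smul \<rho> "\<Inter>?F"] by blast
qed

end

theory Submission
  imports Defs
begin

text \<open>
  For \<open>0 \<le> t < 1\<close> let \<open>T\<^sub>t x = (1 - t) z + t T x\<close>, where \<open>z\<close> is a star centre of \<open>B\<close>. Since \<open>\<rho>\<close> may
  take the value \<open>\<infinity>\<close>, the contraction estimate for \<open>T\<^sub>t\<close> is not applied to \<open>z\<close> and \<open>T\<^sub>t z\<close> directly: the
  segment between them is cut into \<open>N\<close> pieces short enough to have finite modular, so that the
  orbit \<open>x\<^sub>n = T\<^sub>t\<^sup>n z\<close> satisfies \<open>\<rho> ((x\<^sub>n\<^sub>+\<^sub>1 - x\<^sub>n) / N) \<rightarrow> 0\<close>. If \<open>T x\<^sub>n\<close> tends to \<open>y\<close> along a subsequence,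
  then \<open>(1 - t) z + t y\<close> is a fixed point of \<open>T\<^sub>t\<close>. Finally, let \<open>x\<^sub>t\<close> be fixed by \<open>T\<^sub>t\<close> and let
  \<open>T x\<^sub>t\<close> tend to \<open>y\<close> for some \<open>t \<rightarrow> 1\<close>. The points \<open>x\<^sub>t\<close> need not tend to \<open>y\<close>, but with
  \<open>y\<^sub>t = (1 - t) z + t y\<close> both \<open>\<rho> (x\<^sub>t - y\<^sub>t) = \<rho> (t (T x\<^sub>t - y))\<close> and \<open>\<rho> (y\<^sub>t - y) = \<rho> ((1 - t) (z - y))\<close>
  tend to \<open>0\<close>, whence \<open>T y = y\<close>.
\<close>

section \<open>Limits in the extended nonnegative reals\<close>

lemma ennreal_power_mult_tendsto_0:
  fixes W C :: ennreal
  assumes "W < 1" "C < \<infinity>"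
  shows "(\<lambda>n. W ^ n * C) \<longlonglongrightarrow> 0"
proof -
  obtain w where w: "W = ennreal w" "w \<ge> 0"
    using assms(1) by (cases W) auto
  obtain c where c: "C = ennreal c" "c \<ge> 0"
    using assms(2) by (cases C) auto
  have "w < 1"
    using assms(1) w by (simp add: ennreal_less_iff flip: ennreal_1)
  then have "(\<lambda>n. w ^ n * c) \<longlonglongrightarrow> 0 * c"
    using w(2) by (intro tendsto_intros LIMSEQ_realpow_zero)
  then have "(\<lambda>n. ennreal (w ^ n * c)) \<longlonglongrightarrow> ennreal 0"
    by (intro tendsto_ennrealI) simp
  then show ?thesis
    using w c by (simp add: ennreal_mult ennreal_power)
qed

lemma ennreal_tendsto_0_le:
  fixes f g :: "nat \<Rightarrow> ennreal"
  assumes "g \<longlonglongrightarrow> 0" "\<And>n. f n \<le> g n"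
  shows "f \<longlonglongrightarrow> 0"
  using tendsto_sandwich[OF _ _ tendsto_const assms(1), of f] assms(2) by simp

section \<open>Inequalities and limits for modulars\<close>

context modular
begin

lemma modular_zero [simp]: "\<rho> 0 = 0"
  by (simp add: modular_eq_0_iff)

lemma modular_uminus [simp]: "\<rho> (- x) = \<rho> x"
  using modular_unit_scale[of "-1" x] by simp

lemma modular_minus_commute: "\<rho> (x - y) = \<rho> (y - x)"
  using modular_uminus[of "x - y"] by simp

lemma modular_scale_le:
  assumes "0 \<le> t" "t \<le> 1"
  shows "\<rho> (of_real t *\<^sub>s x) \<le> \<rho> x"
  using modular_convex_comb[of t "1 - t" x 0] assms by simp

text \<open>Induction on \<open>N\<close>: the mean of \<open>N + 1\<close> vectors is the convex
  combination, with weights \<open>N / (N + 1)\<close> and \<open>1 / (N + 1)\<close>, of the mean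
  of the first \<open>N\<close> and the last vector.\<close>

lemma modular_mean_le: "\<rho> (of_real (1 / real N) *\<^sub>s (\<Sum>i<N. v i)) \<le> (\<Sum>i<N. \<rho> (v i))"
proof (induction N)
  case (Suc N)
  define S where "S = (\<Sum>i<N. v i)"
  let ?a = "real N / (real N + 1)" and ?b = "1 / (real N + 1)"
  have "of_real (1 / real (Suc N)) *\<^sub>s (\<Sum>i<Suc N. v i) = of_real ?b *\<^sub>s S + of_real ?b *\<^sub>s v N"
    by (simp add: S_def scale_right_distrib add.commute)
  also have "of_real ?b *\<^sub>s S = of_real ?a *\<^sub>s of_real (1 / real N) *\<^sub>s S"
  \<comment> \<open>For \<open>N = 0\<close> the quotient \<open>1 / real N\<close> is 0 by
    convention, but \<open>S\<close> is then the empty sum and both sides vanish.\<close>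
  proof (cases "N = 0")
    case False
    then have "?b = ?a * (1 / real N)"
      by simp
    then show ?thesis
      by (simp only: scale_scale flip: of_real_mult)
  qed (simp add: S_def)
  also have "\<rho> (\<dots> + of_real ?b *\<^sub>s v N) \<le> \<rho> (of_real (1 / real N) *\<^sub>s S) + \<rho> (v N)"
    by (intro modular_convex_comb) (auto simp: field_simps)
  also have "\<dots> \<le> (\<Sum>i<N. \<rho> (v i)) + \<rho> (v N)"
    using Suc.IH by (intro add_mono) (simp_all add: S_def)
  finally show ?case
    by simp
qed simp

text \<open>Stands in for the triangle inequality, which a modular need not satisfy; the price is
  the factor \<open>1 / N\<close> inside \<open>\<rho>\<close>.\<close>

lemma modular_telescope_le:
  "\<rho> (of_real (1 / real N) *\<^sub>s (u N - u 0)) \<le> (\<Sum>i<N. \<rho> (u (Suc i) - u i))"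
  using modular_mean_le[of N "\<lambda>i. u (Suc i) - u i"] by (simp only: sum_lessThan_telescope)

text \<open>The factor 1/3 from the telescope bound is harmless here, since \<open>\<rho>\<close>
  vanishes only at 0.\<close>

lemma eq_if_three_step_tendsto_0:
  assumes "(\<lambda>n. \<rho> (x - u n)) \<longlonglongrightarrow> 0" "(\<lambda>n. \<rho> (u n - v n)) \<longlonglongrightarrow> 0" "(\<lambda>n. \<rho> (v n - y)) \<longlonglongrightarrow> 0"
  shows "x = y"
proof -
  let ?p = "of_real (1 / real 3) *\<^sub>s (y - x)"
  have "\<rho> ?p \<le> \<rho> (x - u n) + \<rho> (u n - v n) + \<rho> (v n - y)" for n
    using modular_telescope_le[of 3 "(!) [x, u n, v n, y]"]
    by (simp add: numeral_3_eq_3 modular_minus_commute add.assoc)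
  moreover have "(\<lambda>n. \<rho> (x - u n) + \<rho> (u n - v n) + \<rho> (v n - y)) \<longlonglongrightarrow> 0 + 0 + 0"
    using assms by (intro tendsto_add)
  ultimately have "\<rho> ?p \<le> 0"
    by (intro LIMSEQ_le_const) auto
  then show ?thesis
    by (auto simp: modular_eq_0_iff)
qed

abbreviation "X \<equiv> modular_space smul \<rho>"

lemma modular_space_tendsto:
  assumes "x \<in> X" "t \<longlonglongrightarrow> 0" "\<And>n. t n \<noteq> (0 :: real)"
  shows "(\<lambda>n. \<rho> (of_real (t n) *\<^sub>s x)) \<longlonglongrightarrow> 0"
proof -
  have "filterlim (\<lambda>n. of_real (t n) :: 'k) (at 0) sequentially"
    using tendsto_of_real[OF assms(2), where 'a = 'k] assms(3) by (simp add: filterlim_at)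
  then show ?thesis
    using assms(1) unfolding modular_space_def by (auto intro: filterlim_compose)
qed

lemma modular_space_diff:
  assumes "x \<in> X" "y \<in> X"
  shows "x - y \<in> X"
proof -
  have half: "((\<lambda>c. \<rho> ((2 * c) *\<^sub>s x)) \<longlongrightarrow> 0) (at 0)" if "x \<in> X" for x
  proof -
    have "((\<lambda>c::'k. 2 * c) \<longlongrightarrow> 2 * 0) (at 0)"
      by (intro tendsto_intros)
    then have "filterlim (\<lambda>c::'k. 2 * c) (at 0) (at 0)"
      by (auto simp: filterlim_at eventually_at_filter)
    then show ?thesis
      using that unfolding modular_space_def by (auto intro: filterlim_compose)
  qed
  \<comment> \<open>The left argument is the midpoint of \<open>(2 * c) *\<^sub>s x\<close> and
    \<open>- ((2 * c) *\<^sub>s y)\<close>.\<close>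
  have le: "\<rho> (c *\<^sub>s (x - y)) \<le> \<rho> ((2 * c) *\<^sub>s x) + \<rho> ((2 * c) *\<^sub>s y)" for c
  proof -
    have "\<rho> (of_real (1/2) *\<^sub>s (2 * c) *\<^sub>s x + of_real (1/2) *\<^sub>s - ((2 * c) *\<^sub>s y))
      \<le> \<rho> ((2 * c) *\<^sub>s x) + \<rho> (- ((2 * c) *\<^sub>s y))"
      by (intro modular_convex_comb) auto
    then show ?thesis
      by (simp add: scale_right_diff_distrib)
  qed
  have "((\<lambda>c. \<rho> ((2 * c) *\<^sub>s x) + \<rho> ((2 * c) *\<^sub>s y)) \<longlongrightarrow> 0) (at 0)"
    using tendsto_add[OF half half, of x y] assms by simp
  then have "((\<lambda>c. \<rho> (c *\<^sub>s (x - y))) \<longlongrightarrow> 0) (at 0)"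
    by (rule tendsto_sandwich[OF _ _ tendsto_const, rotated -1]) (use le in auto)
  then show ?thesis
    by (simp add: modular_space_def)
qed

text \<open>The supremum ranges over vectors of finite positive modular only, so later uses must
  first secure finiteness.\<close>

lemma modular_growth_bound:
  assumes "x \<in> X" "\<rho> x < \<infinity>"
  shows "\<rho> (of_real t *\<^sub>s x) \<le> modular_growth smul \<rho> t * \<rho> x"
proof (cases "\<rho> x = 0")
  case False
  then have pos: "0 < \<rho> x"
    by (simp add: zero_less_iff_neq_zero)
  have "\<rho> (of_real t *\<^sub>s x) / \<rho> x \<le> modular_growth smul \<rho> t"
    unfolding modular_growth_def using assms pos by (intro SUP_upper) auto
  then have "\<rho> (of_real t *\<^sub>s x) / \<rho> x * \<rho> x \<le> modular_growth smul \<rho> t * \<rho> x"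
    by (rule mult_right_mono) simp
  then show ?thesis
    using assms False by (simp add: ennreal_divide_times)
qed (auto simp: modular_eq_0_iff)

end

section \<open>Nonexpansive maps on a star-shaped set\<close>

locale star_shaped_nonexpansive = modular smul \<rho>
  for smul :: "'k::real_normed_field \<Rightarrow> 'a::ab_group_add \<Rightarrow> 'a" (infixr \<open>*\<^sub>s\<close> 75)
    and \<rho> :: "'a \<Rightarrow> ennreal" +
  fixes B :: "'a set" and T :: "'a \<Rightarrow> 'a" and z :: 'a
  assumes growth: "regular_growth smul \<rho>"
    and subset: "B \<subseteq> X"
    and closed: "modular_closed smul \<rho> B"
    and centre: "z \<in> B"
    and star: "x \<in> B \<Longrightarrow> a > 0 \<Longrightarrow> b > 0 \<Longrightarrow> a + b = 1 \<Longrightarrow> of_real a *\<^sub>s z + of_real b *\<^sub>s x \<in> B"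
    and self: "x \<in> B \<Longrightarrow> T x \<in> B"
    and nonexpansive: "x \<in> B \<Longrightarrow> y \<in> B \<Longrightarrow> \<rho> (T x - T y) \<le> \<rho> (x - y)"
    and compact_closure: "modular_compact \<rho> (modular_closure smul \<rho> (T ` B))"
begin

definition toward :: "real \<Rightarrow> 'a \<Rightarrow> 'a" where
  "toward t x = of_real (1 - t) *\<^sub>s z + of_real t *\<^sub>s x"

lemma toward_0 [simp]: "toward 0 x = z"
  by (simp add: toward_def)

lemma toward_in:
  assumes "x \<in> B" "0 \<le> t" "t < 1"
  shows "toward t x \<in> B"
  \<comment> \<open>\<open>star\<close> wants both weights positive; for \<open>t = 0\<close> the
    point is the centre itself.\<close>
  using assms star[of x "1 - t" t] centre by (cases "t = 0") (auto simp: toward_def)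

lemma toward_diff: "toward t x - toward t y = of_real t *\<^sub>s (x - y)"
  by (simp add: toward_def scale_right_diff_distrib)

lemma toward_diff_same: "toward s x - toward t x = of_real (s - t) *\<^sub>s (x - z)"
  by (simp add: toward_def algebra_simps)

lemma toward_diff_self: "toward t x - x = of_real (1 - t) *\<^sub>s (z - x)"
  by (simp add: toward_def algebra_simps)

lemma diff_in_space: "x \<in> B \<Longrightarrow> y \<in> B \<Longrightarrow> x - y \<in> X"
  using subset modular_space_diff by blast

text \<open>As \<open>B\<close> is closed, it contains the closure of the image, so \<open>T\<close>
  may be applied to the limit \<open>y\<close>.\<close>

lemma convergent_subsequence:
  assumes "\<And>n. x n \<in> B"
  obtains r y where "strict_mono (r :: nat \<Rightarrow> nat)" "y \<in> B" "(\<lambda>n. \<rho> (T (x (r n)) - y)) \<longlonglongrightarrow> 0"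
proof -
  have "modular_closure smul \<rho> (T ` B) \<subseteq> B"
    unfolding modular_closure_def by (rule hull_minimal) (use self closed in auto)
  moreover have "T (x n) \<in> modular_closure smul \<rho> (T ` B)" for n
    unfolding modular_closure_def by (rule hull_inc) (use assms in simp)
  then obtain r y where "strict_mono (r :: nat \<Rightarrow> nat)" "y \<in> modular_closure smul \<rho> (T ` B)"
    "modular_converges \<rho> ((\<lambda>n. T (x n)) \<circ> r) y"
    using compact_closure unfolding modular_compact_def by meson
  ultimately show thesis
    using that by (auto simp: modular_converges_def)
qed

section \<open>Fixed points of the contracted maps\<close>

context
  fixes t :: real
  assumes t: "0 \<le> t" "t < 1"
begin

definition S :: "'a \<Rightarrow> 'a" where
  "S x = toward t (T x)"

lemma S_in: "x \<in> B \<Longrightarrow> S x \<in> B"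
  using t by (simp add: S_def toward_in self)

lemma S_funpow_in: "x \<in> B \<Longrightarrow> (S ^^ n) x \<in> B"
  by (induction n) (auto simp: S_in)

lemma S_funpow_bound:
  assumes "x \<in> B" "y \<in> B" "\<rho> (x - y) < \<infinity>"
  shows "\<rho> ((S ^^ n) x - (S ^^ n) y) \<le> modular_growth smul \<rho> t ^ n * \<rho> (x - y)"
proof (induction n)
  case (Suc n)
  let ?W = "modular_growth smul \<rho> t" and ?x = "(S ^^ n) x" and ?y = "(S ^^ n) y"
  have W: "?W < 1"
    using growth t by (auto simp: regular_growth_def)
  have mem: "?x \<in> B" "?y \<in> B"
    using assms by (simp_all add: S_funpow_in)
  have le: "\<rho> (T ?x - T ?y) \<le> ?W ^ n * \<rho> (x - y)"
    using nonexpansive[OF mem] Suc.IH by (rule order_trans)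
  \<comment> \<open>The induction hypothesis thus keeps the modular finite, as the growth bound for
    the next iterate requires.\<close>
  have "?W ^ n \<noteq> \<infinity>"
    using W by (auto simp: power_eq_top_ennreal)
  then have "?W ^ n * \<rho> (x - y) < \<infinity>"
    using assms(3) by (simp add: ennreal_mult_less_top less_top)
  then have fin: "\<rho> (T ?x - T ?y) < \<infinity>"
    using le by (rule le_less_trans[rotated])
  have "\<rho> (S ?x - S ?y) = \<rho> (of_real t *\<^sub>s (T ?x - T ?y))"
    by (simp add: S_def toward_diff)
  also have "\<dots> \<le> ?W * \<rho> (T ?x - T ?y)"
    using mem fin by (intro modular_growth_bound diff_in_space self)
  also have "\<dots> \<le> ?W * (?W ^ n * \<rho> (x - y))"
    using le by (rule mult_left_mono) simp
  finally show ?case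
    by (simp add: mult.assoc)
qed simp

lemma S_orbit_tendsto:
  obtains N :: nat
  where "0 < N" "(\<lambda>n. \<rho> (of_real (1 / real N) *\<^sub>s ((S ^^ Suc n) z - (S ^^ n) z))) \<longlonglongrightarrow> 0"
proof -
  let ?d = "T z - z"
  have d: "?d \<in> X"
    using centre self by (simp add: diff_in_space)
  \<comment> \<open>Small multiples of a vector of \<open>X\<close> have modular near 0, hence
    finite; this fixes the number of pieces.\<close>
  have "(\<lambda>n. 1 / real (Suc n)) \<longlonglongrightarrow> 0"
    using LIMSEQ_inverse_real_of_nat by (simp add: inverse_eq_divide)
  then have "(\<lambda>n. \<rho> (of_real (1 / real (Suc n)) *\<^sub>s ?d)) \<longlonglongrightarrow> 0"
    by (intro modular_space_tendsto d) auto
  then have "\<forall>\<^sub>F n in sequentially. \<rho> (of_real (1 / real (Suc n)) *\<^sub>s ?d) < \<infinity>"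
    by (rule order_tendstoD) simp
  then obtain m where m: "\<rho> (of_real (1 / real (Suc m)) *\<^sub>s ?d) < \<infinity>"
    using eventually_happens by force
  define N where "N = Suc m"
  \<comment> \<open>Equally spaced points on the segment from \<open>q 0 = z\<close> to
    \<open>q N = S z\<close>.\<close>
  define q where "q i = toward (real i / real N * t) (T z)" for i
  have q_in: "q i \<in> B" if "i \<le> N" for i
  proof -
    have "real i / real N * t \<le> 1 * t"
      using that t by (intro mult_right_mono) (auto simp: N_def)
    then show ?thesis
      unfolding q_def using t centre by (intro toward_in self) auto
  qed
  have "q (Suc i) - q i = of_real t *\<^sub>s of_real (1 / real N) *\<^sub>s ?d" for i
  proof -
    have "real (Suc i) / real N * t - real i / real N * t = t * (1 / real N)"
      by (simp add: add_divide_distrib distrib_right)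
    then show ?thesis
      by (simp only: q_def toward_diff_same of_real_mult scale_scale)
  qed
  then have "\<rho> (q (Suc i) - q i) \<le> \<rho> (of_real (1 / real N) *\<^sub>s ?d)" for i
    using t by (simp only: modular_scale_le less_imp_le)
  then have fin: "\<rho> (q (Suc i) - q i) < \<infinity>" for i
    using m unfolding N_def by (rule le_less_trans)
  have bound: "\<rho> (of_real (1 / real N) *\<^sub>s ((S ^^ Suc n) z - (S ^^ n) z))
      \<le> (\<Sum>i<N. modular_growth smul \<rho> t ^ n * \<rho> (q (Suc i) - q i))" for n
  proof -
    have "N \<noteq> 0"
      by (simp add: N_def)
    then have "q 0 = z" "q N = S z"
      by (simp_all add: q_def S_def)
    then have "\<rho> (of_real (1 / real N) *\<^sub>s ((S ^^ Suc n) z - (S ^^ n) z))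
        \<le> (\<Sum>i<N. \<rho> ((S ^^ n) (q (Suc i)) - (S ^^ n) (q i)))"
      using modular_telescope_le[of N "\<lambda>i. (S ^^ n) (q i)"] by (simp add: funpow_swap1)
    also have "\<dots> \<le> (\<Sum>i<N. modular_growth smul \<rho> t ^ n * \<rho> (q (Suc i) - q i))"
      by (intro sum_mono S_funpow_bound q_in fin) auto
    finally show ?thesis .
  qed
  have "modular_growth smul \<rho> t < 1"
    using growth t by (auto simp: regular_growth_def)
  then have "(\<lambda>n. \<Sum>i<N. modular_growth smul \<rho> t ^ n * \<rho> (q (Suc i) - q i)) \<longlonglongrightarrow> 0"
    by (intro tendsto_null_sum ennreal_power_mult_tendsto_0 fin)
  then have "(\<lambda>n. \<rho> (of_real (1 / real N) *\<^sub>s ((S ^^ Suc n) z - (S ^^ n) z))) \<longlonglongrightarrow> 0"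
    using bound by (rule ennreal_tendsto_0_le)
  then show thesis
    by (intro that[of N]) (simp_all add: N_def)
qed

lemma S_fixed_point: "\<exists>x \<in> B. S x = x"
proof -
  define x where "x n = (S ^^ n) z" for n
  have x_in: "x n \<in> B" for n
    by (simp add: x_def S_funpow_in centre)
  have x_Suc: "x (Suc n) = S (x n)" for n
    by (simp add: x_def)
  obtain r y where r: "strict_mono (r :: nat \<Rightarrow> nat)" and y: "y \<in> B"
    and lim: "(\<lambda>n. \<rho> (T (x (r n)) - y)) \<longlonglongrightarrow> 0"
    using convergent_subsequence[OF x_in] .
  define w where "w = toward t y"
  have w_in: "w \<in> B"
    using y t by (simp add: w_def toward_in)
  have S_le: "\<rho> (S u - S v) \<le> \<rho> (u - v)" if "u \<in> B" "v \<in> B" for u v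
  proof -
    have "\<rho> (S u - S v) \<le> \<rho> (T u - T v)"
      using t by (simp add: S_def toward_diff modular_scale_le)
    also have "\<dots> \<le> \<rho> (u - v)"
      using that by (rule nonexpansive)
    finally show ?thesis .
  qed
  have "\<rho> (x (Suc (r n)) - w) \<le> \<rho> (T (x (r n)) - y)" for n
    using t by (simp add: x_Suc S_def w_def toward_diff modular_scale_le)
  with lim have x1: "(\<lambda>n. \<rho> (x (Suc (r n)) - w)) \<longlonglongrightarrow> 0"
    by (rule ennreal_tendsto_0_le)
  \<comment> \<open>\<open>S\<close> is itself nonexpansive, so one more iterate carries the limit
    \<open>w\<close> to \<open>S w\<close>.\<close>
  then have x2: "(\<lambda>n. \<rho> (x (Suc (Suc (r n))) - S w)) \<longlonglongrightarrow> 0"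
    by (rule ennreal_tendsto_0_le) (simp only: x_Suc[of "Suc (r _)"] S_le x_in w_in)
  obtain N :: nat where N: "0 < N"
    and orbit: "(\<lambda>n. \<rho> (of_real (1 / real N) *\<^sub>s (x (Suc n) - x n))) \<longlonglongrightarrow> 0"
    using S_orbit_tendsto unfolding x_def[symmetric] by blast
  \<comment> \<open>Successive orbit points are known to be close only after scaling by
    \<open>1 / N\<close>, so \<open>w\<close> and \<open>S w\<close> are compared after this
    scaling; it does not increase the other two modulars.\<close>
  define c where "c = (of_real (1 / real N) :: 'k)"
  have c_le: "\<rho> (c *\<^sub>s u - c *\<^sub>s v) \<le> \<rho> (u - v)" for u v
    using N modular_scale_le[of "1 / real N" "u - v"]
    by (simp add: c_def scale_right_diff_distrib)
  have "filterlim (\<lambda>n. Suc (r n)) sequentially sequentially"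
    using r by (intro filterlim_compose[OF filterlim_Suc] filterlim_subseq)
  from filterlim_compose[OF orbit this]
  have step: "(\<lambda>n. \<rho> (c *\<^sub>s x (Suc (Suc (r n))) - c *\<^sub>s x (Suc (r n)))) \<longlonglongrightarrow> 0"
    by (simp add: c_def scale_right_diff_distrib)
  have "c *\<^sub>s S w = c *\<^sub>s w"
  proof (rule eq_if_three_step_tendsto_0)
    show "(\<lambda>n. \<rho> (c *\<^sub>s S w - c *\<^sub>s x (Suc (Suc (r n))))) \<longlonglongrightarrow> 0"
      using x2 by (rule ennreal_tendsto_0_le) (simp only: modular_minus_commute[of "c *\<^sub>s S w"] c_le)
    show "(\<lambda>n. \<rho> (c *\<^sub>s x (Suc (r n)) - c *\<^sub>s w)) \<longlonglongrightarrow> 0"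
      using x1 by (rule ennreal_tendsto_0_le) (rule c_le)
  qed (rule step)
  then have "S w = w"
    using N by (simp add: c_def)
  then show ?thesis
    using w_in by blast
qed

end

section \<open>Passage to the limit as the parameter tends to 1\<close>

lemma fixed_point: "\<exists>x \<in> B. T x = x"
proof -
  \<comment> \<open>These parameters tend to 1 but stay below it, so \<open>1 - t (r n)\<close> is a
    nonzero null sequence, as \<open>modular_space_tendsto\<close> demands.\<close>
  define t where "t n = 1 - 1 / real (Suc n)" for n
  have t: "0 \<le> t n" "t n < 1" for n
    by (simp_all add: t_def)
  have "\<forall>n. \<exists>x \<in> B. toward (t n) (T x) = x"
    using S_fixed_point[OF t] S_def[OF t] by simp
  then obtain x where x_in: "\<And>n. x n \<in> B" and x_fix: "\<And>n. toward (t n) (T (x n)) = x n"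
    by metis
  obtain r y where r: "strict_mono (r :: nat \<Rightarrow> nat)" and y: "y \<in> B"
    and lim: "(\<lambda>n. \<rho> (T (x (r n)) - y)) \<longlonglongrightarrow> 0"
    using convergent_subsequence[OF x_in] .
  define w where "w n = toward (t (r n)) y" for n
  have w_in: "w n \<in> B" for n
    using y t by (simp add: w_def toward_in)
  have "\<rho> (x (r n) - w n) \<le> \<rho> (T (x (r n)) - y)" for n
    using toward_diff[of "t (r n)" "T (x (r n))" y] t
    by (simp add: x_fix w_def modular_scale_le less_imp_le)
  with lim have xw: "(\<lambda>n. \<rho> (x (r n) - w n)) \<longlonglongrightarrow> 0"
    by (rule ennreal_tendsto_0_le)
  have "(\<lambda>n. 1 / real (Suc n)) \<longlonglongrightarrow> 0"
    using LIMSEQ_inverse_real_of_nat by (simp add: inverse_eq_divide)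
  from LIMSEQ_subseq_LIMSEQ[OF this r] have "(\<lambda>n. 1 - t (r n)) \<longlonglongrightarrow> 0"
    by (simp add: t_def o_def)
  then have wy: "(\<lambda>n. \<rho> (w n - y)) \<longlonglongrightarrow> 0"
    unfolding w_def toward_diff_self
    using modular_space_tendsto[OF diff_in_space[OF centre y]] t by (metis diff_eq_eq add_0 less_irrefl)
  have "T y = y"
  \<comment> \<open>The chain runs from \<open>T y\<close> through \<open>T (w n)\<close> and
    \<open>T (x (r n))\<close> to \<open>y\<close>; nonexpansiveness reduces the first two links to
    \<open>wy\<close> and \<open>xw\<close>.\<close>
  proof (rule eq_if_three_step_tendsto_0)
    show "(\<lambda>n. \<rho> (T y - T (w n))) \<longlonglongrightarrow> 0"
      using wy by (rule ennreal_tendsto_0_le) (metis nonexpansive y w_in modular_minus_commute)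
    show "(\<lambda>n. \<rho> (T (w n) - T (x (r n)))) \<longlonglongrightarrow> 0"
      using xw by (rule ennreal_tendsto_0_le) (metis nonexpansive x_in w_in modular_minus_commute)
  qed (rule lim)
  then show ?thesis
    using y by blast
qed

end

theorem theorem3p1:
  fixes smul :: "'k::real_normed_field \<Rightarrow> 'a::ab_group_add \<Rightarrow> 'a"
    and \<rho> :: "'a \<Rightarrow> ennreal"
    and B :: "'a set"
    and T :: "'a \<Rightarrow> 'a"
  assumes "modular smul \<rho>"
    and "modular_complete smul \<rho>"
    and "regular_growth smul \<rho>"
    and "B \<subseteq> modular_space smul \<rho>"
    and "modular_closed smul \<rho> B"
    and "star_shaped smul B"
    and "T \<in> B \<rightarrow> B"
    and "modular_nonexpansive_on \<rho> B T"
    and "modular_compact \<rho> (modular_closure smul \<rho> (T ` B))"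
  shows "\<exists>x \<in> B. T x = x"
proof -
  obtain z where z: "z \<in> B" "\<And>x a b. x \<in> B \<Longrightarrow> a > 0 \<Longrightarrow> b > 0 \<Longrightarrow> a + b = 1 \<Longrightarrow>
      smul (of_real a) z + smul (of_real b) x \<in> B"
    using assms(6) unfolding star_shaped_def by blast
  interpret modular smul \<rho>
    by (rule assms(1))
  interpret star_shaped_nonexpansive smul \<rho> B T z
    by unfold_locales (use assms z in \<open>auto simp: modular_nonexpansive_on_def\<close>)
  show ?thesis
    by (rule fixed_point)
qed

end
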